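(* Let $n=2$, $l=1$, and assume $a_j>\lambda_j^2$ for $j=1,2$. Let $B_u$ be an invertible real $2\times2$ matrix, write $B_uT=(\tilde B_{u1},\tilde B_{u2})$, let $$\tilde C\in\Big(\lambda_2-\frac{\lambda_2^2}{\sqrt{a_2}},\,0\Big)\cup(0,+\infty),$$ and put $$\tilde B_{p2}=-\tilde B_{u1}\frac{H}{\tilde C}+\tilde B_{u2}\frac{\tilde C-\lambda_2}{\lambda_2\tilde C}.$$ Then there is $\delta>0$ such that for every $\tilde B_{p1}\in\mathbb R^2$ with $|\tilde B_{p1}|<\delta$, the boundary matrix $B=(B_u,B_p)$ with $B_pT=(\tilde B_{p1},\tilde B_{p2})$ satisfies the generalized Kreiss condition (GKC).
   Context: $F$ is a real $2\times2$ matrix, $T$ is real invertible with $T^{-1}FT=\mathrm{diag}(\lambda_1,\lambda_2)$, $\lambda_1>0>\lambda_2$, and $\bar A=T\,\mathrm{diag}(a_1,a_2)T^{-1}$ with $a_j>0$. $T=(R_1^U,R_1^S)$ with $R_1^U,R_1^S$ its first and second columns. $\hat B$ is a real $1\times2$ matrix with $\hat BR_1^U\ne0$ and $H=-(\hat BR_1^U)^{-1}\hat BR_1^S\in\mathbb R$. GKC: let $A=\begin{pmatrix}F&I_2\\ \bar A-F^2&-F\end{pmatrix}$, $S=\mathrm{diag}(0,-I_2)$, $M(\eta,\xi_0)=A^{-1}(\eta S-\xi_0I_4)$ for $\eta\ge0$, $\xi_0\in\mathbb C$, $\mathrm{Re}\,\xi_0>0$; $M$ has exactly $2$ eigenvalues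 (with multiplicity) of negative real part. A right-stable matrix $R_M^S(\eta,\xi_0)$ is a full-rank $4\times2$ matrix with $MR_M^S=R_M^SS_-$ where all eigenvalues of the $2\times2$ matrix $S_-$ have negative real part. $B$ satisfies the GKC if there is $c_K>0$ such that $|\det\{BR_M^S(\eta,\xi_0)\}|\ge c_K\sqrt{\det\{R_M^{S*}(\eta,\xi_0)R_M^S(\eta,\xi_0)\}}$ for all $\eta\ge0$ and $\mathrm{Re}\,\xi_0>0$ ($*$: conjugate transpose; independent of the choice of $R_M^S$). *)

theory Defs
  imports "HOL-Analysis.Analysis"
begin

definition diag_mat :: "'a::zero ^ 'n \<Rightarrow> 'a ^ 'n ^ 'n" where
  "diag_mat d = (\<chi> i j. if i = j then d $ i else 0)"

text \<open>Block matrices are indexed by sum types: \<open>Inl\<close> indexes the first block, \<open>Inr\<close> the second.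
  In particular, a \<open>4 \<times> 4\<close> matrix of \<open>2 \<times> 2\<close> blocks is indexed by \<open>2 + 2\<close>.\<close>

definition block_row :: "'a ^ 'n ^ 'm \<Rightarrow> 'a ^ 'q ^ 'm \<Rightarrow> 'a ^ ('n + 'q) ^ 'm" where
  "block_row P Q = (\<chi> i j. case j of Inl k \<Rightarrow> P $ i $ k | Inr k \<Rightarrow> Q $ i $ k)"

definition block_mat ::
  "'a ^ 'n ^ 'm \<Rightarrow> 'a ^ 'q ^ 'm \<Rightarrow> 'a ^ 'n ^ 'p \<Rightarrow> 'a ^ 'q ^ 'p \<Rightarrow> 'a ^ ('n + 'q) ^ ('m + 'p)" where
  "block_mat P Q R S =
    (\<chi> i. case i of Inl k \<Rightarrow> block_row P Q $ k | Inr k \<Rightarrow> block_row R S $ k)"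

abbreviation cmat :: "real ^ 'n ^ 'm \<Rightarrow> complex ^ 'n ^ 'm" where
  "cmat \<equiv> map_matrix complex_of_real"

definition conj_transpose :: "complex ^ 'n ^ 'm \<Rightarrow> complex ^ 'm ^ 'n" where
  "conj_transpose A = map_matrix cnj (transpose A)"

definition is_eigenvalue :: "complex ^ 'n ^ 'n \<Rightarrow> complex \<Rightarrow> bool" where
  "is_eigenvalue A \<mu> \<longleftrightarrow> (\<exists>v. v \<noteq> 0 \<and> A *v v = \<mu> *s v)"

definition A_mat :: "real ^ 2 ^ 2 \<Rightarrow> real ^ 2 ^ 2 \<Rightarrow> real ^ (2 + 2) ^ (2 + 2)" where
  "A_mat F Abar = block_mat F (mat 1) (Abar - F ** F) (- F)"

definition S_mat :: "real ^ (2 + 2) ^ (2 + 2)" where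
  "S_mat = block_mat 0 0 0 (- mat 1)"

definition M_mat ::
  "real ^ 2 ^ 2 \<Rightarrow> real ^ 2 ^ 2 \<Rightarrow> real \<Rightarrow> complex \<Rightarrow> complex ^ (2 + 2) ^ (2 + 2)" where
  "M_mat F Abar \<eta> \<xi>0 = cmat (matrix_inv (A_mat F Abar)) ** (\<eta> *\<^sub>R cmat S_mat - mat \<xi>0)"

definition right_stable :: "complex ^ (2 + 2) ^ (2 + 2) \<Rightarrow> complex ^ 2 ^ (2 + 2) \<Rightarrow> bool" where
  "right_stable M R \<longleftrightarrow>
    rank R = 2 \<and>
    (\<exists>Sm :: complex ^ 2 ^ 2. M ** R = R ** Sm \<and> (\<forall>\<mu>. is_eigenvalue Sm \<mu> \<longrightarrow> Re \<mu> < 0))"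

text \<open>The inequality does not depend on the choice of the right-stable matrix (replacing \<open>R\<close> by
  \<open>R ** P\<close> multiplies both sides by \<open>cmod (det P)\<close>), so it is required for all of them.  The Gram
  determinant of \<open>R\<close> is real and nonnegative, hence the use of \<open>Re\<close>.\<close>

definition GKC :: "real ^ 2 ^ 2 \<Rightarrow> real ^ 2 ^ 2 \<Rightarrow> real ^ (2 + 2) ^ 2 \<Rightarrow> bool" where
  "GKC F Abar B \<longleftrightarrow>
    (\<exists>cK > 0. \<forall>\<eta> \<ge> 0. \<forall>\<xi>0. Re \<xi>0 > 0 \<longrightarrow>
      (\<forall>R. right_stable (M_mat F Abar \<eta> \<xi>0) R \<longrightarrow>
        cmod (det (cmat B ** R)) \<ge> cK * sqrt (Re (det (conj_transpose R ** R)))))"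

end

theory Submission
  imports Defs
begin

text \<open>Conjugation by \<open>T\<close> diagonalizes \<open>F\<close> and \<open>Abar\<close> simultaneously, so the eigenvalue problem
  \<open>\<mu> A v = (\<eta> S - \<xi>) v\<close> splits into one problem \<open>\<mu> (\<nu> u + p) = - \<xi> u\<close>,
  \<open>\<mu> ((a - \<nu>\<^sup>2) u - \<nu> p) = - (\<eta> + \<xi>) p\<close> for each pair of eigenvalues \<open>(\<nu>, a)\<close>.  Its characteristic
  equation is \<open>a \<mu>\<^sup>2 - \<eta> \<nu> \<mu> - \<xi> (\<xi> + \<eta>) = 0\<close>.  For \<open>a > \<nu>\<^sup>2\<close> it has one root in each open half
  plane, and the stable root \<open>\<mu>\<close> belongs to the vector \<open>(u, p) = (1, - (\<nu> + q))\<close> with \<open>q = \<xi> / \<mu>\<close>.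

  Every right-stable matrix therefore has, in these coordinates, halves \<open>U\<close> and \<open>C U\<close> with
  \<open>C = diag (- (\<nu>\<^sub>j + q\<^sub>j))\<close> (lemma \<open>stable_half_relation\<close>).  The factor \<open>det U\<close> appears in the same
  power on both sides of the Kreiss inequality and drops out.  Since the ratios \<open>q\<^sub>j\<close> are bounded
  (\<open>stable_ratio_bound\<close>), so is the remaining Gram determinant, and it suffices to bound
  \<open>det (Bu T + Bp T C)\<close> away from zero (\<open>GKC_from_boundary_symbol\<close>).

  For \<open>bp1 = 0\<close>, multilinearity reduces this determinant to
  \<open>det (Bu T) (1 - (\<nu>\<^sub>2 + q\<^sub>2) k)\<close> with \<open>k = (Ct - \<nu>\<^sub>2) / (\<nu>\<^sub>2 Ct)\<close>: the multiple of \<open>bu1\<close> in \<open>bp2\<close> does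
  not contribute.  The last factor is \<open>1\<close> if \<open>Ct = \<nu>\<^sub>2\<close>; otherwise it vanishes exactly when \<open>q\<^sub>2\<close> equals
  the real number \<open>v = \<nu>\<^sub>2\<^sup>2 / (Ct - \<nu>\<^sub>2)\<close>.  The range prescribed for \<open>Ct\<close> puts \<open>v\<close> either on the positive axis away
  from \<open>- \<nu>\<^sub>2\<close> or below \<open>- sqrt a\<^sub>2\<close>, and the stable ratio stays at a positive distance from every such
  point (\<open>stable_ratio_avoids\<close>, the heart of the matter).  A small \<open>bp1\<close> perturbs the determinant by
  \<open>O (norm bp1)\<close>, uniformly in the frequencies, because the \<open>q\<^sub>j\<close> are bounded.\<close>

section \<open>The scalar dispersion relation\<close>

text \<open>The quotient \<open>q\<close> is homogeneous of degree zero in \<open>(\<eta>, \<xi>)\<close>; working with it instead of the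
  stable root \<open>\<mu>\<close> turns all estimates into bounds that are uniform in the frequencies.\<close>

definition stable_ratio :: "real \<Rightarrow> real \<Rightarrow> real \<Rightarrow> complex \<Rightarrow> complex \<Rightarrow> bool" where
  "stable_ratio a \<nu> \<eta> \<xi> q \<longleftrightarrow>
    (\<exists>\<mu> :: complex. Re \<mu> < 0 \<and> a * \<mu>\<^sup>2 - of_real (\<eta> * \<nu>) * \<mu> - \<xi> * (\<xi> + \<eta>) = 0 \<and> q = \<xi> / \<mu>)"

text \<open>The roots are \<open>\<sigma> / 2 \<plusminus> w\<close> with \<open>\<sigma> = \<eta> \<nu> / a\<close> real, so the claim is \<open>Re w > \<bar>\<sigma>\<bar> / 2\<close>.  If this
  failed, real and imaginary part of the equation for \<open>w\<^sup>2\<close> would give, for \<open>\<xi> = x + i z\<close>,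
  \<open>z\<^sup>2 (2 x + \<eta>)\<^sup>2 \<le> (\<nu>\<^sup>2 / a) \<eta>\<^sup>2 z\<^sup>2 \<le> \<eta>\<^sup>2 z\<^sup>2\<close> with \<open>z \<noteq> 0\<close>, which contradicts \<open>x > 0\<close>.\<close>

lemma characteristic_roots_split:
  fixes a \<nu> \<eta> :: real and \<xi> :: complex
  assumes a: "a > \<nu>\<^sup>2" and \<eta>: "\<eta> \<ge> 0" and \<xi>: "Re \<xi> > 0"
  obtains \<mu>m \<mu>p :: complex where "Re \<mu>m < 0" "Re \<mu>p > 0"
    "a * (\<mu>m + \<mu>p) = \<eta> * \<nu>" "a * (\<mu>m * \<mu>p) = - (\<xi> * (\<xi> + \<eta>))"
proof -
  have a0: "a > 0" using a zero_le_power2[of \<nu>] by linarith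
  define \<sigma> where "\<sigma> = \<eta> * \<nu> / a"
  define w where "w = csqrt (\<sigma>\<^sup>2 / 4 + \<xi> * (\<xi> + \<eta>) / a)"
  have w2: "w\<^sup>2 = \<sigma>\<^sup>2 / 4 + \<xi> * (\<xi> + \<eta>) / a" by (simp add: w_def)
  define x z where "x = Re \<xi>" and "z = Im \<xi>"
  have x: "x > 0" using \<xi> by (simp add: x_def)
  have X: "(Re w)\<^sup>2 - (Im w)\<^sup>2 = \<sigma>\<^sup>2 / 4 + (x\<^sup>2 + \<eta> * x - z\<^sup>2) / a"
    using arg_cong[OF w2, of Re] by (simp add: x_def z_def power2_eq_square algebra_simps)
  have Y: "2 * Re w * Im w = z * (2 * x + \<eta>) / a"
    using arg_cong[OF w2, of Im] by (simp add: x_def z_def power2_eq_square algebra_simps)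
  have "(Re w)\<^sup>2 > \<sigma>\<^sup>2 / 4"
  proof (rule ccontr)
    assume "\<not> ?thesis"
    then have r: "(Re w)\<^sup>2 \<le> \<sigma>\<^sup>2 / 4" by simp
    define N where "N = z\<^sup>2 - x\<^sup>2 - \<eta> * x"
    have m: "(Im w)\<^sup>2 \<le> N / a" using X r by (simp add: N_def diff_divide_distrib add_divide_distrib)
    have "0 \<le> N / a" using m zero_le_power2 order_trans by blast
    then have N0: "0 \<le> N" using a0 by (simp add: zero_le_divide_iff)
    have "x\<^sup>2 > 0" "\<eta> * x \<ge> 0" using x \<eta> by auto
    then have Nz: "N \<le> z\<^sup>2" and z2: "z\<^sup>2 > 0" using N0 unfolding N_def by linarith+
    have "(z * (2 * x + \<eta>) / a)\<^sup>2 = 4 * ((Re w)\<^sup>2 * (Im w)\<^sup>2)"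
      unfolding Y[symmetric] by (simp add: power2_eq_square)
    also have "\<dots> \<le> 4 * (\<sigma>\<^sup>2 / 4 * (N / a))"
      using r m by (intro mult_left_mono mult_mono) auto
    also have "\<dots> = \<eta>\<^sup>2 * (\<nu>\<^sup>2 / a) * N / a\<^sup>2"
      using a0 by (simp add: \<sigma>_def field_simps power2_eq_square)
    also have "\<dots> \<le> \<eta>\<^sup>2 * 1 * z\<^sup>2 / a\<^sup>2"
      using a a0 N0 x \<eta> by (intro divide_right_mono mult_mono) (auto simp: Nz)
    finally have "(z * (2 * x + \<eta>))\<^sup>2 \<le> \<eta>\<^sup>2 * z\<^sup>2"
      using a0 by (simp add: power_divide divide_le_cancel)
    then have "(2 * x + \<eta>)\<^sup>2 \<le> \<eta>\<^sup>2"
      using z2 by (simp add: power_mult_distrib mult.commute)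
    then show False using x \<eta> power2_le_imp_le[of "2 * x + \<eta>" \<eta>] by simp
  qed
  then have "\<bar>\<sigma>\<bar> / 2 < \<bar>Re w\<bar>"
    by (intro power2_less_imp_less[where x="\<bar>\<sigma>\<bar> / 2"]) (simp_all add: power_divide)
  moreover have "Re w \<ge> 0" unfolding w_def by (rule Re_csqrt)
  ultimately have w: "\<bar>\<sigma>\<bar> / 2 < Re w" by simp
  show ?thesis
  proof (rule that[of "\<sigma> / 2 - w" "\<sigma> / 2 + w"])
    show "a * (of_real (\<sigma> / 2) - w + (of_real (\<sigma> / 2) + w)) = of_real (\<eta> * \<nu>)"
      using a0 by (simp add: \<sigma>_def)
    have "(of_real (\<sigma> / 2) - w) * (of_real (\<sigma> / 2) + w) = - (\<xi> * (\<xi> + \<eta>) / a)"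
      using w2 by (simp add: algebra_simps power2_eq_square)
    then show "a * ((of_real (\<sigma> / 2) - w) * (of_real (\<sigma> / 2) + w)) = - (\<xi> * (\<xi> + \<eta>))"
      using a0 by simp
  qed (use w in auto)
qed

text \<open>Dividing the characteristic equation by \<open>\<mu>\<^sup>2\<close> gives
  \<open>(\<xi> + \<eta>) q\<^sup>2 = a \<xi> - \<eta> \<nu> q\<close>.  Both \<open>cmod \<xi>\<close> and \<open>\<eta>\<close> are at most \<open>cmod (\<xi> + \<eta>)\<close>, since \<open>\<xi>\<close> lies
  in the right half plane, and this leaves the quadratic inequality
  \<open>(cmod q)\<^sup>2 \<le> a + \<bar>\<nu>\<bar> cmod q\<close>.\<close>

lemma stable_ratio_bound:
  fixes \<xi> q :: complex
  assumes a: "a > \<nu>\<^sup>2" and \<eta>: "\<eta> \<ge> 0" and \<xi>: "Re \<xi> > 0" and q: "stable_ratio a \<nu> \<eta> \<xi> q"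
  shows "cmod q \<le> a + \<bar>\<nu>\<bar> + 1"
proof (rule ccontr)
  assume "\<not> ?thesis"
  then have big: "cmod q > a + \<bar>\<nu>\<bar> + 1" by simp
  have a0: "a > 0" using a zero_le_power2[of \<nu>] by linarith
  obtain \<mu> :: complex where \<mu>: "Re \<mu> < 0" "a * \<mu>\<^sup>2 - \<eta> * \<nu> * \<mu> - \<xi> * (\<xi> + \<eta>) = 0" and q: "q = \<xi> / \<mu>"
    using q unfolding stable_ratio_def by (elim exE conjE) (rule that)
  have n0: "\<mu> \<noteq> 0" "\<xi> \<noteq> 0" using \<mu>(1) \<xi> by auto
  have "(\<xi> + \<eta>) * q\<^sup>2 = (\<xi> * (\<xi> + \<eta>)) * \<xi> / \<mu>\<^sup>2"
    by (simp add: q power2_eq_square)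
  also have "\<xi> * (\<xi> + \<eta>) = a * \<mu>\<^sup>2 - \<eta> * \<nu> * \<mu>" using \<mu>(2) by simp
  also have "(a * \<mu>\<^sup>2 - \<eta> * \<nu> * \<mu>) * \<xi> / \<mu>\<^sup>2 = a * \<xi> - \<eta> * \<nu> * q"
    using n0 by (simp add: q left_diff_distrib diff_divide_distrib power2_eq_square)
  finally have eq: "(\<xi> + \<eta>) * q\<^sup>2 = a * \<xi> - \<eta> * \<nu> * q" .
  have l1: "cmod \<xi> \<le> cmod (\<xi> + \<eta>)"
    unfolding cmod_def using \<eta> \<xi> by (intro real_sqrt_le_mono) (auto intro!: power_mono)
  have l2: "\<eta> \<le> cmod (\<xi> + \<eta>)" using complex_Re_le_cmod[of "\<xi> + \<eta>"] \<xi> by simp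
  have pos: "cmod (\<xi> + \<eta>) > 0" using l1 n0 zero_less_norm_iff[of \<xi>] by linarith
  have "cmod (\<xi> + \<eta>) * (cmod q)\<^sup>2 = cmod (a * \<xi> - \<eta> * \<nu> * q)"
    unfolding eq[symmetric] by (simp add: norm_mult norm_power)
  also have "\<dots> \<le> a * cmod \<xi> + \<eta> * (\<bar>\<nu>\<bar> * cmod q)"
    using norm_triangle_ineq4[of "a * \<xi>" "\<eta> * \<nu> * q"] a0 \<eta> by (simp add: norm_mult)
  also have "\<dots> \<le> a * cmod (\<xi> + \<eta>) + cmod (\<xi> + \<eta>) * (\<bar>\<nu>\<bar> * cmod q)"
    using l1 l2 a0 by (intro add_mono mult_left_mono mult_right_mono) auto
  also have "\<dots> = cmod (\<xi> + \<eta>) * (a + \<bar>\<nu>\<bar> * cmod q)" by (simp add: algebra_simps)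
  finally have le: "(cmod q)\<^sup>2 \<le> a + \<bar>\<nu>\<bar> * cmod q" using pos by simp
  have "(a + \<bar>\<nu>\<bar> + 1) * cmod q \<le> (cmod q)\<^sup>2"
    using big unfolding power2_eq_square by (intro mult_right_mono) auto
  with le have "(a + 1) * cmod q \<le> a" by (simp add: algebra_simps)
  moreover have "(a + 1) * 1 \<le> (a + 1) * cmod q" using a0 big by (intro mult_left_mono) auto
  ultimately show False by simp
qed

text \<open>All that is needed to locate \<open>q\<close> is contained in \<open>t = \<eta> / \<mu>\<close>.  The dispersion relation expresses
  \<open>t\<close> rationally by \<open>q\<close>, the stability of \<open>\<mu>\<close> gives \<open>Re t \<le> 0\<close>, and \<open>q * cnj t\<close> is a nonnegative
  multiple of \<open>\<xi>\<close>.  The last conclusion treats \<open>\<eta> = 0\<close>: there both \<open>q = sqrt a\<close> and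
  \<open>q = - sqrt a\<close> satisfy the other three, and only the signs of \<open>Re \<mu>\<close> and \<open>Re \<xi>\<close> decide.\<close>

lemma stable_ratio_constraints:
  fixes \<xi> q :: complex
  assumes a: "a > \<nu>\<^sup>2" and \<eta>: "\<eta> \<ge> 0" and \<xi>: "Re \<xi> > 0" and q: "stable_ratio a \<nu> \<eta> \<xi> q"
  obtains t :: complex where "t * (q + \<nu>) = a - q\<^sup>2" "Re t \<le> 0" "Re (q * cnj t) \<ge> 0"
    "t = 0 \<Longrightarrow> q = - sqrt a"
proof -
  have a0: "a > 0" using a zero_le_power2[of \<nu>] by linarith
  obtain \<mu> :: complex where \<mu>: "Re \<mu> < 0" "a * \<mu>\<^sup>2 - \<eta> * \<nu> * \<mu> - \<xi> * (\<xi> + \<eta>) = 0" and q: "q = \<xi> / \<mu>"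
    using q unfolding stable_ratio_def by (elim exE conjE) (rule that)
  have n0: "\<mu> \<noteq> 0" using \<mu>(1) by auto
  have \<xi>q: "\<xi> = q * \<mu>" using n0 q by simp
  show ?thesis
  proof (rule that[of "\<eta> / \<mu>"])
    have "\<mu>\<^sup>2 * (\<eta> / \<mu> * (q + \<nu>)) = q * \<mu> * \<eta> + \<eta> * \<nu> * \<mu>"
      using n0 by (simp add: power2_eq_square field_simps)
    also have "\<dots> = a * \<mu>\<^sup>2 - (q * \<mu>)\<^sup>2"
      using \<mu>(2) unfolding \<xi>q by (simp add: power2_eq_square algebra_simps)
    finally have "\<mu>\<^sup>2 * (\<eta> / \<mu> * (q + \<nu>)) = \<mu>\<^sup>2 * (a - q\<^sup>2)"
      by (simp add: power_mult_distrib algebra_simps)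
    then show eq: "\<eta> / \<mu> * (q + \<nu>) = a - q\<^sup>2"
      by (rule mult_left_cancel[THEN iffD1, rotated]) (use n0 in simp)
    show "Re (\<eta> / \<mu>) \<le> 0"
      using \<mu>(1) \<eta> by (simp add: Re_divide divide_nonpos_nonneg mult_nonneg_nonpos)
    have "q * cnj (\<eta> / \<mu>) = \<eta> * \<xi> / (\<mu> * cnj \<mu>)" using n0 by (simp add: q)
    also have "\<dots> = of_real (\<eta> / (cmod \<mu>)\<^sup>2) * \<xi>" by (simp add: flip: complex_norm_square)
    finally show "Re (q * cnj (\<eta> / \<mu>)) \<ge> 0" using \<eta> \<xi> by simp
    assume "\<eta> / \<mu> = 0"
    with eq have "q\<^sup>2 = (of_real (sqrt a))\<^sup>2" using a0 by (simp flip: of_real_power)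
    then have "q = of_real (sqrt a) \<or> q = - of_real (sqrt a)" by (rule power2_eq_iff[THEN iffD1])
    moreover have "q \<noteq> of_real (sqrt a)"
    proof
      assume "q = of_real (sqrt a)"
      then have "Re \<xi> = sqrt a * Re \<mu>" by (simp add: \<xi>q)
      with mult_pos_neg[of "sqrt a" "Re \<mu>"] \<mu>(1) \<xi> a0 show False by simp
    qed
    ultimately show "q = - sqrt a" by simp
  qed
qed

text \<open>The point \<open>v\<close> cannot be a limit of stable ratios, because near \<open>v\<close> the constraints of the previous
  lemma contradict each other.  Solving the dispersion relation gives
  \<open>t = (a - q\<^sup>2) / (q + \<nu>)\<close>, which depends continuously on \<open>q\<close> as \<open>v \<noteq> - \<nu>\<close>, and is real at \<open>q = v\<close>.
  If the limit is positive, \<open>Re t \<le> 0\<close> fails.  If it is negative, then \<open>v > 0\<close> and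
  \<open>Re (q * cnj t) \<ge> 0\<close> fails.  It is zero only for \<open>v = sqrt a\<close>, the ratio that belongs to the
  unstable root at \<open>\<eta> = 0\<close>; there \<open>t = - (q - v) h q\<close> with \<open>h v > 0\<close>, so
  \<open>Re (q * cnj t) = v * Re t - (cmod (q - v))\<^sup>2 * Re (h q)\<close>, which is negative for \<open>q \<noteq> v\<close>, while
  \<open>q = v\<close> would mean \<open>t = 0\<close> and hence \<open>q = - sqrt a\<close>.\<close>

lemma stable_ratio_avoids:
  fixes a \<nu> v :: real
  assumes a: "a > \<nu>\<^sup>2" and \<nu>: "\<nu> < 0" and v: "v > 0 \<and> v \<noteq> - \<nu> \<or> v < - sqrt a"
  obtains \<epsilon> where "\<epsilon> > 0"
    "\<And>\<eta> \<xi> q. \<eta> \<ge> 0 \<Longrightarrow> Re \<xi> > 0 \<Longrightarrow> stable_ratio a \<nu> \<eta> \<xi> q \<Longrightarrow> \<epsilon> \<le> cmod (q - v)"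
proof -
  have a0: "a > 0" using a zero_le_power2[of \<nu>] by linarith
  have sa: "- \<nu> < sqrt a" using a \<nu> by (intro real_less_rsqrt) auto
  define P where "P q \<longleftrightarrow> (\<exists>t. t * (q + of_real \<nu>) = of_real a - q\<^sup>2 \<and> Re t \<le> 0 \<and> Re (q * cnj t) \<ge> 0 \<and>
    (t = 0 \<longrightarrow> q = - of_real (sqrt a)))" for q
  define g where "g q = (of_real a - q\<^sup>2) / (q + of_real \<nu>)" for q :: complex
  let ?v = "complex_of_real v"
  have vl: "v + \<nu> \<noteq> 0" using v \<nu> real_sqrt_gt_zero[OF a0] by linarith
  then have vl': "?v + of_real \<nu> \<noteq> 0" by (metis of_real_add of_real_eq_0_iff)
  have nz: "\<forall>\<^sub>F q in nhds ?v. q + of_real \<nu> \<noteq> 0"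
    using vl' by (intro tendsto_imp_eventually_ne[where c="?v + of_real \<nu>"] tendsto_intros filterlim_ident)
  have g: "(g \<longlongrightarrow> of_real ((a - v\<^sup>2) / (v + \<nu>))) (nhds ?v)"
    unfolding g_def using vl'
    by (auto intro!: tendsto_eq_intros filterlim_ident)
  have tg: "t = g q" if "t * (q + of_real \<nu>) = of_real a - q\<^sup>2" "q + of_real \<nu> \<noteq> 0" for t q
    using that by (simp add: g_def field_simps)
  consider "(a - v\<^sup>2) / (v + \<nu>) > 0" | "(a - v\<^sup>2) / (v + \<nu>) < 0" "v > 0" | "v = sqrt a"
  proof -
    consider "v < - sqrt a" | "v > 0" "v < - \<nu>" | "- \<nu> < v" "v < sqrt a" | "v = sqrt a" | "v > sqrt a"
      using v by linarith
    then show ?thesis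
    proof cases
      case 1
      then have "a < v\<^sup>2" using a0 real_sqrt_less_iff[of a "v\<^sup>2"] by auto
      moreover have "v + \<nu> < 0" using 1 \<nu> real_sqrt_gt_zero[OF a0] by linarith
      ultimately show ?thesis using that(1) by (simp add: divide_neg_neg)
    next
      case 2
      then have "v\<^sup>2 < a" using sa real_less_rsqrt real_sqrt_less_iff[of "v\<^sup>2" a] by simp
      then show ?thesis using 2 that(2) by (simp add: divide_pos_neg)
    next
      case 3
      then have "v\<^sup>2 < a" using \<nu> real_sqrt_less_iff[of "v\<^sup>2" a] by simp
      then show ?thesis using 3 that(1) by simp
    next
      case 5
      then have "a < v\<^sup>2" using a0 real_sqrt_less_iff[of a "v\<^sup>2"] real_sqrt_gt_zero[OF a0] by simp
      then show ?thesis using 5 sa \<nu> that(2) by (simp add: divide_neg_pos)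
    qed (use that in auto)
  qed
  then have "\<forall>\<^sub>F q in nhds ?v. \<not> P q"
  proof cases
    case 1
    have "((\<lambda>q. Re (g q)) \<longlongrightarrow> (a - v\<^sup>2) / (v + \<nu>)) (nhds ?v)"
      using tendsto_Re[OF g] by simp
    from order_tendstoD(1)[OF this 1] nz show ?thesis
      by eventually_elim (use tg in \<open>fastforce simp: P_def\<close>)
  next
    case 2
    have "((\<lambda>q. Re (q * cnj (g q))) \<longlongrightarrow> Re (?v * cnj (of_real ((a - v\<^sup>2) / (v + \<nu>))))) (nhds ?v)"
      by (intro tendsto_intros g filterlim_ident)
    moreover have "Re (?v * cnj (of_real ((a - v\<^sup>2) / (v + \<nu>)))) < 0"
      using mult_pos_neg[OF 2(2,1)] by simp
    ultimately have "\<forall>\<^sub>F q in nhds ?v. Re (q * cnj (g q)) < 0" by (rule order_tendstoD)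
    with nz show ?thesis
      by eventually_elim (use tg in \<open>fastforce simp: P_def\<close>)
  next
    case 3
    have v0: "v > 0" "v\<^sup>2 = a" using 3 a0 by auto
    define h where "h q = (?v + q) / (q + of_real \<nu>)" for q
    have "(h \<longlongrightarrow> of_real (2 * v / (v + \<nu>))) (nhds ?v)"
      unfolding h_def using vl' by (auto intro!: tendsto_eq_intros filterlim_ident)
    from tendsto_Re[OF this] have "((\<lambda>q. Re (h q)) \<longlongrightarrow> 2 * v / (v + \<nu>)) (nhds ?v)" by simp
    moreover have "2 * v / (v + \<nu>) > 0" using v0 sa 3 by simp
    ultimately have "\<forall>\<^sub>F q in nhds ?v. Re (h q) > 0" by (rule order_tendstoD)
    with nz show ?thesis
    proof eventually_elim
      case (elim q)
      show ?case
      proof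
        assume "P q"
        then obtain t where t: "t * (q + of_real \<nu>) = of_real a - q\<^sup>2" "Re t \<le> 0" "Re (q * cnj t) \<ge> 0"
          "t = 0 \<longrightarrow> q = - of_real (sqrt a)" unfolding P_def by blast
        have th: "t = - (q - ?v) * h q"
          using tg[OF t(1) elim(1)]
          by (simp add: g_def h_def v0(2)[symmetric] field_simps power2_eq_square elim(1))
        have "q \<noteq> ?v"
        proof
          assume q: "q = ?v"
          with th t(4) have "q = - ?v" using 3 by simp
          with q v0 show False by simp
        qed
        have "q * cnj t = v * cnj t + (q - ?v) * cnj t" by (simp add: algebra_simps)
        also have "(q - ?v) * cnj t = - ((q - ?v) * cnj (q - ?v) * cnj (h q))" by (simp add: th algebra_simps)
        also have "(q - ?v) * cnj (q - ?v) = of_real ((cmod (q - ?v))\<^sup>2)"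
          by (rule complex_norm_square[symmetric])
        finally have "Re (q * cnj t) = v * Re t - (cmod (q - ?v))\<^sup>2 * Re (h q)"
          by (simp del: of_real_power)
        moreover have "v * Re t \<le> 0" using v0 t(2) by (simp add: mult_nonneg_nonpos)
        moreover have "(cmod (q - ?v))\<^sup>2 * Re (h q) > 0" using \<open>q \<noteq> ?v\<close> elim(2) by simp
        ultimately show False using t(3) by linarith
      qed
    qed
  qed
  then obtain \<epsilon> where \<epsilon>: "\<epsilon> > 0" "\<And>q. dist q ?v < \<epsilon> \<Longrightarrow> \<not> P q"
    unfolding eventually_nhds_metric by blast
  show ?thesis
  proof (rule that[OF \<epsilon>(1)])
    fix \<eta> \<xi> q assume "\<eta> \<ge> 0" "Re \<xi> > 0" "stable_ratio a \<nu> \<eta> \<xi> q"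
    then obtain t where "t * (q + \<nu>) = a - q\<^sup>2" "Re t \<le> 0" "Re (q * cnj t) \<ge> 0"
      "t = 0 \<Longrightarrow> q = - sqrt a" by (rule stable_ratio_constraints[OF a]) blast
    then have "P q" unfolding P_def by auto
    then show "\<epsilon> \<le> cmod (q - v)" using \<epsilon>(2)[of q] by (force simp: dist_norm)
  qed
qed

lemma left_eigenvector_imp_eigenvalue:
  fixes S :: "complex ^ 'n ^ 'n"
  assumes "w v* S = \<mu> *s w" "w \<noteq> 0"
  shows "is_eigenvalue S \<mu>"
proof -
  have mat: "mat \<mu> *v x = \<mu> *s x" for x :: "complex ^ 'n"
    by (simp add: mat_def vec_eq_iff matrix_vector_mult_def if_distrib if_distribR cong: if_cong)
  have "(transpose S - mat \<mu>) *v w = 0"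
    using assms(1) by (simp add: matrix_vector_mult_diff_rdistrib mat)
  then have "\<not> invertible (transpose S - mat \<mu>)"
    using assms(2) by (metis invertible_def matrix_left_invertible_ker)
  moreover have "transpose S - mat \<mu> = transpose (S - mat \<mu>)"
    by (auto simp: transpose_def mat_def vec_eq_iff)
  ultimately have "\<not> invertible (S - mat \<mu>)"
    by (simp add: invertible_det_nz det_transpose)
  then obtain x where x: "x \<noteq> 0" "(S - mat \<mu>) *v x = 0"
    by (metis invertible_left_inverse matrix_left_invertible_ker)
  have "S *v x = \<mu> *s x" using x(2) by (simp add: matrix_vector_mult_diff_rdistrib mat)
  with x show ?thesis unfolding is_eigenvalue_def by blast
qed

text \<open>The rows \<open>u\<close>, \<open>p\<close> describe one component of an invariant subspace on which the operator acts by
  the stable matrix \<open>S\<close>.  The linear form that annihilates the stable eigenvector, \<open>w = p + (\<nu> + q) u\<close>,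
  is a left eigenvector for the other, unstable root \<open>n\<close>.  Hence \<open>w v* S = n *s w\<close>, and \<open>w\<close> must
  vanish because \<open>S\<close> has no eigenvalue in the right half plane.\<close>

lemma stable_component:
  fixes a \<nu> \<eta> :: real and \<xi> :: complex
  assumes a: "a > \<nu>\<^sup>2" and \<eta>: "\<eta> \<ge> 0" and \<xi>: "Re \<xi> > 0"
  obtains q :: complex where "stable_ratio a \<nu> \<eta> \<xi> q"
    "\<And>(u :: complex ^ 'n) p S. \<forall>\<mu>. is_eigenvalue S \<mu> \<longrightarrow> Re \<mu> < 0 \<Longrightarrow>
       (of_real \<nu> *s u + p) v* S = (- \<xi>) *s u \<Longrightarrow>
       (of_real (a - \<nu>\<^sup>2) *s u - of_real \<nu> *s p) v* S = (- (\<eta> + \<xi>)) *s p \<Longrightarrow>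
       p = (- (\<nu> + q)) *s u"
proof -
  have a0: "a > 0" using a zero_le_power2[of \<nu>] by linarith
  obtain m n :: complex where mn: "Re m < 0" "Re n > 0" "a * (m + n) = \<eta> * \<nu>" "a * (m * n) = - (\<xi> * (\<xi> + \<eta>))"
    using characteristic_roots_split[OF a \<eta> \<xi>] by metis
  have m0: "m \<noteq> 0" using mn(1) by auto
  define q where "q = \<xi> / m"
  have \<xi>q: "\<xi> = q * m" using m0 q_def by simp
  have nq: "a * n = - (q * (\<xi> + \<eta>))"
  proof -
    have "m * (a * n) = m * (- (q * (\<xi> + \<eta>)))" using mn(4) by (simp add: \<xi>q algebra_simps)
    then have "m * (a * n) = m * - (q * (\<xi> + \<eta>))" by simp
    then show ?thesis using m0 mult_left_cancel by blast
  qed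
  have lin: "- a * \<xi> - q * \<xi> * \<nu> = a * (n * (\<nu> + q))"
  proof -
    have "a * (n * (\<nu> + q)) = a * n * \<nu> + q * (a * (m + n)) - a * \<xi>"
      by (simp add: \<xi>q algebra_simps)
    also have "\<dots> = - a * \<xi> - q * \<xi> * \<nu>" unfolding nq mn(3) by (simp add: algebra_simps)
    finally show ?thesis by simp
  qed
  have "a * m\<^sup>2 - \<eta> * \<nu> * m - \<xi> * (\<xi> + \<eta>) = a * m\<^sup>2 - a * (m + n) * m + a * (m * n)"
    unfolding mn(3,4) by simp
  also have "\<dots> = 0" by (simp add: algebra_simps power2_eq_square)
  finally have "a * m\<^sup>2 - \<eta> * \<nu> * m - \<xi> * (\<xi> + \<eta>) = 0" .
  then have "stable_ratio a \<nu> \<eta> \<xi> q" using mn(1) unfolding stable_ratio_def q_def by blast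
  moreover have "p = (- (\<nu> + q)) *s u"
    if S: "\<forall>\<mu>. is_eigenvalue S \<mu> \<longrightarrow> Re \<mu> < 0"
      and 1: "(of_real \<nu> *s u + p) v* S = (- \<xi>) *s u"
      and 2: "(of_real (a - \<nu>\<^sup>2) *s u - of_real \<nu> *s p) v* S = (- (\<eta> + \<xi>)) *s p"
    for u p :: "complex ^ 'n" and S
  proof -
    define w where "w = p + (\<nu> + q) *s u"
    let ?U = "u v* S" and ?P = "p v* S"
    have lin1: "(c *s x + d *s y) v* S = c *s (x v* S) + d *s (y v* S)" for c d and x y :: "complex ^ 'n"
      by (simp add: vec_eq_iff vector_matrix_mult_def sum.distrib sum_distrib_left algebra_simps)
    have e1: "of_real \<nu> * ?U $ i + ?P $ i = - \<xi> * u $ i" for i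
      using arg_cong[OF 1, of "\<lambda>x. x $ i"] lin1[of "of_real \<nu>" u 1 p] by simp
    have e2: "of_real (a - \<nu>\<^sup>2) * ?U $ i - of_real \<nu> * ?P $ i = - (\<eta> + \<xi>) * p $ i" for i
      using arg_cong[OF 2, of "\<lambda>x. x $ i"] lin1[of "of_real (a - \<nu>\<^sup>2)" u "- of_real \<nu>" p]
      by (simp del: of_real_diff add: left_diff_distrib)
    have wS: "w v* S = n *s w"
    proof (unfold vec_eq_iff, rule allI)
      fix i
      have U: "a * ?U $ i = - (\<xi> * \<nu> * u $ i) - (\<eta> + \<xi>) * p $ i"
      proof -
        have "a * ?U $ i = \<nu> * (of_real \<nu> * ?U $ i + ?P $ i) + (of_real (a - \<nu>\<^sup>2) * ?U $ i - of_real \<nu> * ?P $ i)"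
          by (simp add: algebra_simps power2_eq_square)
        also have "\<dots> = - (\<xi> * \<nu> * u $ i) - (\<eta> + \<xi>) * p $ i"
          unfolding e1 e2 by (simp add: algebra_simps)
        finally show ?thesis .
      qed
      have "a * (w v* S) $ i = a * (of_real \<nu> * ?U $ i + ?P $ i) + q * (a * ?U $ i)"
        using lin1[of 1 p "\<nu> + q" u] by (simp add: w_def algebra_simps)
      also have "\<dots> = (- a * \<xi> - q * \<xi> * \<nu>) * u $ i - q * (\<xi> + \<eta>) * p $ i"
        unfolding e1 U by (simp add: algebra_simps)
      also have "\<dots> = a * (n * (\<nu> + q)) * u $ i + a * n * p $ i" unfolding lin nq by simp
      also have "\<dots> = a * (n *s w) $ i" by (simp add: w_def algebra_simps)
      finally show "(w v* S) $ i = (n *s w) $ i" using a0 by simp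
    qed
    have "w = 0" using left_eigenvector_imp_eigenvalue[OF wS] S mn(2) by force
    then have "p $ i = - ((\<nu> + q) * u $ i)" for i
      unfolding w_def vec_eq_iff eq_neg_iff_add_eq_0 by (simp del: vector_sadd_rdistrib)
    then show ?thesis by (simp add: vec_eq_iff algebra_simps)
  qed
  ultimately show ?thesis by (rule that)
qed

text \<open>For \<open>C \<noteq> \<nu>\<close> the factor equals \<open>- k (q - v)\<close> with \<open>v = \<nu>\<^sup>2 / (C - \<nu>)\<close>, and the bounds on \<open>C\<close>
  say that \<open>v\<close> is one of the points avoided by stable ratios: \<open>C > \<nu>\<close> makes \<open>v\<close> positive,
  \<open>C \<noteq> 0\<close> excludes \<open>v = - \<nu>\<close>, and \<open>\<nu> - \<nu>\<^sup>2 / sqrt a < C < \<nu>\<close> gives \<open>v < - sqrt a\<close>.  For \<open>C = \<nu>\<close> the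
  point \<open>v\<close> moves to infinity and the factor is constant.\<close>

lemma stable_ratio_boundary_factor:
  fixes a \<nu> C k :: real
  assumes a: "a > \<nu>\<^sup>2" and \<nu>: "\<nu> < 0"
    and C: "C \<in> {\<nu> - \<nu>\<^sup>2 / sqrt a <..< 0} \<union> {0 <..}"
    and k: "k = (C - \<nu>) / (\<nu> * C)"
  obtains \<epsilon> where "\<epsilon> > 0"
    "\<And>\<eta> \<xi> q. \<eta> \<ge> 0 \<Longrightarrow> Re \<xi> > 0 \<Longrightarrow> stable_ratio a \<nu> \<eta> \<xi> q \<Longrightarrow>
      \<epsilon> \<le> cmod (1 - (of_real \<nu> + q) * of_real k)"
proof (cases "C = \<nu>")
  case True
  then show ?thesis using that[of 1] k by simp
next
  case False
  have C0: "C \<noteq> 0" using C by auto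
  have a0: "a > 0" using a zero_le_power2[of \<nu>] by linarith
  define v where "v = \<nu>\<^sup>2 / (C - \<nu>)"
  have k0: "k \<noteq> 0" using k False \<nu> C0 by simp
  have kv: "1 - \<nu> * k = k * v"
  proof -
    have "k * v = \<nu> / C" using False \<nu> by (simp add: k v_def power2_eq_square)
    moreover have "\<nu> * k = (C - \<nu>) / C" using \<nu> by (simp add: k)
    ultimately show ?thesis using C0 by (simp add: diff_divide_distrib)
  qed
  have "v > 0 \<and> v \<noteq> - \<nu> \<or> v < - sqrt a"
  proof (cases "C > \<nu>")
    case True
    have "v \<noteq> - \<nu>"
    proof
      assume "v = - \<nu>"
      then have "\<nu>\<^sup>2 = - \<nu> * (C - \<nu>)" using True by (simp add: v_def divide_eq_eq)
      then have "\<nu> * C = 0" by (simp add: power2_eq_square algebra_simps)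
      then show False using C0 \<nu> by simp
    qed
    then show ?thesis using True \<nu> by (simp add: v_def)
  next
    case neg: False
    then have "\<nu> - \<nu>\<^sup>2 / sqrt a < C" using C \<nu> by auto
    then have "- (C - \<nu>) < \<nu>\<^sup>2 / sqrt a" by simp
    then have "- (C - \<nu>) * sqrt a < \<nu>\<^sup>2" using a0 by (simp only: pos_less_divide_eq real_sqrt_gt_zero)
    moreover have "- (C - \<nu>) * sqrt a = - sqrt a * (C - \<nu>)" by (simp add: algebra_simps)
    ultimately have "- sqrt a * (C - \<nu>) < \<nu>\<^sup>2" by (simp only:)
    moreover have "C - \<nu> < 0" using neg False by simp
    ultimately have "v < - sqrt a" by (simp only: v_def neg_divide_less_eq)
    then show ?thesis ..
  qed
  then obtain \<epsilon> where \<epsilon>: "\<epsilon> > 0"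
    "\<And>\<eta> \<xi> q. \<eta> \<ge> 0 \<Longrightarrow> Re \<xi> > 0 \<Longrightarrow> stable_ratio a \<nu> \<eta> \<xi> q \<Longrightarrow> \<epsilon> \<le> cmod (q - of_real v)"
    using stable_ratio_avoids[OF a \<nu>] by blast
  show ?thesis
  proof (rule that[of "\<bar>k\<bar> * \<epsilon>"])
    fix \<eta> \<xi> q assume "\<eta> \<ge> 0" "Re \<xi> > 0" "stable_ratio a \<nu> \<eta> \<xi> q"
    then have "\<epsilon> \<le> cmod (q - of_real v)" by (rule \<epsilon>(2))
    then have "\<bar>k\<bar> * \<epsilon> \<le> cmod (of_real (- k) * (q - of_real v))"
      unfolding norm_mult using \<epsilon>(1) by (intro mult_mono) auto
    also have "of_real (- k) * (q - of_real v) = of_real (k * v) - q * of_real k"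
      by (simp add: algebra_simps)
    also have "\<dots> = 1 - (of_real \<nu> + q) * of_real k"
      unfolding kv[symmetric] by (simp add: algebra_simps)
    finally show "\<bar>k\<bar> * \<epsilon> \<le> cmod (1 - (of_real \<nu> + q) * of_real k)" .
  qed (use k0 \<epsilon>(1) in simp)
qed

section \<open>Block matrices\<close>

definition upper_half :: "'a ^ 'n ^ ('m::finite + 'p::finite) \<Rightarrow> 'a ^ 'n ^ 'm" where
  "upper_half X = (\<chi> i. X $ Inl i)"

definition lower_half :: "'a ^ 'n ^ ('m::finite + 'p::finite) \<Rightarrow> 'a ^ 'n ^ 'p" where
  "lower_half X = (\<chi> i. X $ Inr i)"

lemma sum_UNIV_Plus:
  "(\<Sum>k\<in>(UNIV :: ('a::finite + 'b::finite) set). f k) = (\<Sum>k\<in>UNIV. f (Inl k)) + (\<Sum>k\<in>UNIV. f (Inr k))"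
  by (simp flip: UNIV_Plus_UNIV add: sum.Plus)

lemma halves_block_mat_mult:
  fixes P :: "'a::semiring_1 ^ 'n ^ 'm"
  shows "upper_half (block_mat P Q R S ** X) = P ** upper_half X + Q ** lower_half X"
    and "lower_half (block_mat P Q R S ** X) = R ** upper_half X + S ** lower_half X"
  by (simp_all add: vec_eq_iff upper_half_def lower_half_def block_mat_def block_row_def
      matrix_matrix_mult_def sum_UNIV_Plus)

lemma block_row_mult:
  fixes P :: "'a::semiring_1 ^ 'n ^ 'm"
  shows "block_row P Q ** X = P ** upper_half X + Q ** lower_half X"
  by (simp add: vec_eq_iff upper_half_def lower_half_def block_row_def
      matrix_matrix_mult_def sum_UNIV_Plus)

lemma halves_mult:
  "upper_half (X ** Y) = upper_half X ** Y" "lower_half (X ** Y) = lower_half X ** Y"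
  by (simp_all add: vec_eq_iff upper_half_def lower_half_def matrix_matrix_mult_def)

lemma map_matrix_block_mat:
  "map_matrix f (block_mat P Q R S)
    = block_mat (map_matrix f P) (map_matrix f Q) (map_matrix f R) (map_matrix f S)"
  by (auto simp: vec_eq_iff block_mat_def block_row_def map_matrix_def split: sum.splits)

lemma map_matrix_block_row:
  "map_matrix f (block_row P Q) = block_row (map_matrix f P) (map_matrix f Q)"
  by (auto simp: vec_eq_iff block_row_def map_matrix_def split: sum.splits)

lemma cmat_simps:
  "cmat (A ** B) = cmat A ** cmat B" "cmat (A + A') = cmat A + cmat A'"
  "cmat (A - A') = cmat A - cmat A'" "cmat (- A) = - cmat A" "cmat 0 = 0"
  "cmat (mat r) = mat (of_real r)" "cmat (diag_mat d) = diag_mat (\<chi> i. of_real (d $ i))"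
  by (simp_all add: vec_eq_iff map_matrix_def matrix_matrix_mult_def mat_def diag_mat_def)

lemma mat_mult_eq: "mat k ** X = (\<chi> i. k *s X $ i)"
  for X :: "'a::comm_semiring_1 ^ 'n ^ 'm"
  by (simp add: vec_eq_iff mat_def matrix_matrix_mult_def if_distrib if_distribR cong: if_cong)

lemma mat_mult_commute: "X ** mat k = mat k ** X"
  for X :: "'a::comm_semiring_1 ^ 'n ^ 'm"
  by (simp add: mat_mult_eq)
    (simp add: vec_eq_iff mat_def matrix_matrix_mult_def if_distrib if_distribR mult.commute
      cong: if_cong)

lemma matrix_ring_simps:
  fixes A B :: "'a::ring_1 ^ 'n ^ 'm"
  shows "(A - B) ** X = A ** X - B ** X" "(- A) ** X = - (A ** X)"
    "A ** (- X) = - (A ** X)" "0 ** X = 0" "X ** 0 = 0" "A ** (Y - Z) = A ** Y - A ** Z"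
    "(A + B) ** X = A ** X + B ** X"
  by (simp_all add: vec_eq_iff matrix_matrix_mult_def algebra_simps sum_subtractf sum_negf sum.distrib)

lemma diag_mat_mult_row: "(diag_mat d ** X) $ i = d $ i *s X $ i"
  for X :: "'a::comm_semiring_1 ^ 'n ^ 'm"
  by (simp add: vec_eq_iff diag_mat_def matrix_matrix_mult_def if_distrib if_distribR cong: if_cong)

lemma mult_diag_mat_entry: "(X ** diag_mat d) $ i $ j = X $ i $ j * d $ j"
  for X :: "'a::comm_semiring_1 ^ 'n ^ 'm"
  by (simp add: diag_mat_def matrix_matrix_mult_def if_distrib if_distribR cong: if_cong)

lemma matrix_mult_row: "(X ** Y) $ i = X $ i v* Y"
  for X :: "'a::comm_semiring_1 ^ 'n ^ 'm"
  by (simp add: vec_eq_iff matrix_matrix_mult_def vector_matrix_mult_def mult.commute)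

lemma matrix_inv_inverse:
  assumes "invertible A"
  shows "A ** matrix_inv A = mat 1" "matrix_inv A ** A = mat 1"
  using someI_ex[OF assms[unfolded invertible_def]] by (simp_all add: matrix_inv_def)

section \<open>Right-stable matrices\<close>

text \<open>Block elimination: \<open>F u + p = 0\<close> turns the second block row \<open>(Abar - F\<^sup>2) u - F p\<close> into
  \<open>Abar u\<close>, so that the determinant of the block matrix is that of \<open>Abar\<close> up to sign.\<close>

lemma invertible_A_mat:
  assumes "invertible Abar"
  shows "invertible (A_mat F Abar)"
proof -
  \<comment> \<open>The kernel vector \<open>x\<close> is treated as a one-column matrix, to apply the rules for halves.\<close>
  have "x = 0" if x: "A_mat F Abar *v x = 0" for x
  proof -
    define X :: "real ^ 1 ^ (2 + 2)" where "X = (\<chi> i j. x $ i)"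
    have X0: "A_mat F Abar ** X = 0"
      using x by (simp add: vec_eq_iff X_def matrix_matrix_mult_def matrix_vector_mult_def)
    let ?u = "upper_half X" and ?p = "lower_half X"
    have "F ** ?u + ?p = 0" "(Abar - F ** F) ** ?u - F ** ?p = 0"
      using arg_cong[OF X0, of upper_half] arg_cong[OF X0, of lower_half]
      unfolding A_mat_def halves_block_mat_mult
      by (simp_all add: upper_half_def lower_half_def vec_eq_iff matrix_matrix_mult_def mat_def
          if_distrib if_distribR sum_negf cong: if_cong)
    then have p: "?p = - (F ** ?u)" and "Abar ** ?u = 0"
      by (simp_all add: add_eq_0_iff2 matrix_ring_simps flip: matrix_mul_assoc)
    then have "?u = 0"
      using assms by (metis invertible_def matrix_mul_assoc matrix_mul_lid matrix_ring_simps(5))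
    with p have "?p = 0" by (simp add: vec_eq_iff matrix_matrix_mult_def)
    have "x $ i = 0" for i
    proof (cases i)
      case (Inl k)
      with arg_cong[OF \<open>?u = 0\<close>, of "\<lambda>v. v $ k $ 1"] show ?thesis by (simp add: upper_half_def X_def)
    next
      case (Inr k)
      with arg_cong[OF \<open>?p = 0\<close>, of "\<lambda>v. v $ k $ 1"] show ?thesis by (simp add: lower_half_def X_def)
    qed
    then show ?thesis by (simp add: vec_eq_iff)
  qed
  then show ?thesis by (metis invertible_left_inverse matrix_left_invertible_ker)
qed

text \<open>Multiplying the invariance relation by \<open>A\<close> removes the inverse: \<open>A R S = (\<eta> S\<^sub>0 - \<xi>) R\<close>, where
  \<open>S\<^sub>0 = S_mat\<close>.  The two conclusions are the block rows of this equation.\<close>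

lemma M_mat_equations:
  assumes Abar: "invertible Abar" and R: "M_mat F Abar \<eta> \<xi> ** R = R ** S"
  shows "(cmat F ** upper_half R + lower_half R) ** S = mat (- \<xi>) ** upper_half R"
    and "(cmat (Abar - F ** F) ** upper_half R - cmat F ** lower_half R) ** S
      = mat (- (\<eta> + \<xi>)) ** lower_half R"
proof -
  have pencil: "\<eta> *\<^sub>R cmat S_mat - mat \<xi> = block_mat (mat (- \<xi>)) 0 0 (mat (- (\<eta> + \<xi>)))"
    by (auto simp: vec_eq_iff S_mat_def block_mat_def block_row_def map_matrix_def mat_def of_real_def
        split: sum.splits)
  have "A_mat F Abar ** matrix_inv (A_mat F Abar) = mat 1"
    using invertible_A_mat[OF Abar] by (rule matrix_inv_inverse)
  then have inv: "cmat (A_mat F Abar) ** cmat (matrix_inv (A_mat F Abar)) = mat 1"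
    by (metis cmat_simps(1,6) of_real_1)
  have "cmat (A_mat F Abar) ** (M_mat F Abar \<eta> \<xi> ** R) = (\<eta> *\<^sub>R cmat S_mat - mat \<xi>) ** R"
    unfolding M_mat_def matrix_mul_assoc inv by simp
  then have "cmat (A_mat F Abar) ** R ** S = block_mat (mat (- \<xi>)) 0 0 (mat (- (\<eta> + \<xi>))) ** R"
    unfolding R pencil by (simp add: matrix_mul_assoc)
  from arg_cong[OF this, of upper_half] arg_cong[OF this, of lower_half]
  show "(cmat F ** upper_half R + lower_half R) ** S = mat (- \<xi>) ** upper_half R"
    and "(cmat (Abar - F ** F) ** upper_half R - cmat F ** lower_half R) ** S
      = mat (- (\<eta> + \<xi>)) ** lower_half R"
    unfolding A_mat_def map_matrix_block_mat halves_block_mat_mult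
      halves_mult[of "block_mat P Q V W ** X" for P Q V W X]
    by (simp_all add: cmat_simps matrix_ring_simps)
qed

section \<open>Gram determinants\<close>

lemma gram_det_le:
  fixes P Q :: "complex ^ 2 ^ 2"
  assumes P: "\<And>i j. cmod (P $ i $ j) \<le> \<tau>" and Q: "\<And>i j. cmod (Q $ i $ j) \<le> \<tau>"
  shows "cmod (det (conj_transpose P ** P + conj_transpose Q ** Q)) \<le> 32 * \<tau> ^ 4"
proof -
  define G where "G = conj_transpose P ** P + conj_transpose Q ** Q"
  have \<tau>: "\<tau> \<ge> 0" using P[of 1 1] norm_ge_zero order_trans by blast
  have pr: "cmod (cnj (X $ i $ k) * X $ i $ j) \<le> \<tau>\<^sup>2"
    if "\<And>i j. cmod (X $ i $ j) \<le> \<tau>" for X :: "complex ^ 2 ^ 2" and i j k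
    unfolding norm_mult power2_eq_square using that \<tau> by (intro mult_mono) auto
  have G: "cmod (G $ i $ j) \<le> 4 * \<tau>\<^sup>2" for i j
  proof -
    have "G $ i $ j = (cnj (P $ 1 $ i) * P $ 1 $ j + cnj (P $ 2 $ i) * P $ 2 $ j)
        + (cnj (Q $ 1 $ i) * Q $ 1 $ j + cnj (Q $ 2 $ i) * Q $ 2 $ j)"
      by (simp add: G_def conj_transpose_def map_matrix_def transpose_def matrix_matrix_mult_def sum_2)
    also have "cmod \<dots> \<le> (\<tau>\<^sup>2 + \<tau>\<^sup>2) + (\<tau>\<^sup>2 + \<tau>\<^sup>2)"
      using P Q by (intro norm_triangle_mono pr) auto
    finally show ?thesis by simp
  qed
  have "cmod (det G) \<le> cmod (G $ 1 $ 1 * G $ 2 $ 2) + cmod (G $ 1 $ 2 * G $ 2 $ 1)"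
    unfolding det_2 by (rule norm_triangle_ineq4)
  also have "\<dots> \<le> (4 * \<tau>\<^sup>2) * (4 * \<tau>\<^sup>2) + (4 * \<tau>\<^sup>2) * (4 * \<tau>\<^sup>2)"
    unfolding norm_mult by (intro add_mono mult_mono G) auto
  also have "\<dots> = 32 * \<tau> ^ 4" by (simp add: power4_eq_xxxx power2_eq_square)
  finally show ?thesis by (simp add: G_def)
qed

lemma conj_transpose_mult: "conj_transpose (A ** B) = conj_transpose B ** conj_transpose A"
  by (simp add: vec_eq_iff conj_transpose_def map_matrix_def transpose_def matrix_matrix_mult_def mult.commute)

lemma det_conj_transpose: "det (conj_transpose A) = cnj (det A)" for A :: "complex ^ 2 ^ 2"
  by (simp add: det_2 conj_transpose_def map_matrix_def transpose_def mult.commute)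

lemma gram_halves:
  "conj_transpose R ** R = conj_transpose (upper_half R) ** upper_half R
    + conj_transpose (lower_half R) ** lower_half R"
  by (simp add: vec_eq_iff conj_transpose_def map_matrix_def transpose_def matrix_matrix_mult_def
      upper_half_def lower_half_def sum_UNIV_Plus)

lemma gram_det_factor:
  fixes P Q U :: "complex ^ 2 ^ 2"
  assumes "upper_half R = P ** U" "lower_half R = Q ** U"
  shows "det (conj_transpose R ** R)
    = (cmod (det U))\<^sup>2 * det (conj_transpose P ** P + conj_transpose Q ** Q)"
proof -
  have "conj_transpose R ** R
      = conj_transpose U ** (conj_transpose P ** P + conj_transpose Q ** Q) ** U"
    unfolding gram_halves assms conj_transpose_mult
    by (simp add: matrix_add_ldistrib matrix_ring_simps matrix_mul_assoc)
  then show ?thesis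
    by (simp add: det_mul det_conj_transpose complex_norm_square[symmetric] mult.commute mult.left_commute)
qed


section \<open>Reduction of the Kreiss condition to the boundary symbol\<close>

text \<open>In the coordinates given by \<open>T\<close>, the block equations for \<open>R\<close> hold separately for each pair of
  rows, and \<open>stable_component\<close> applies to each pair.  The ratios depend on the frequencies alone,
  not on \<open>R\<close>; only the common right factor \<open>U\<close> does.\<close>

lemma stable_half_relation:
  fixes T F Abar :: "real ^ 2 ^ 2" and lam a :: "real ^ 2" and \<xi> :: complex
  assumes T: "invertible T"
    and F: "matrix_inv T ** F ** T = diag_mat lam"
    and Abar: "Abar = T ** diag_mat a ** matrix_inv T"
    and a: "\<And>j. a $ j > (lam $ j)\<^sup>2"
    and \<eta>: "\<eta> \<ge> 0" and \<xi>: "Re \<xi> > 0"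
  obtains q :: "complex ^ 2" where "\<And>j. stable_ratio (a $ j) (lam $ j) \<eta> \<xi> (q $ j)"
    "\<And>R. right_stable (M_mat F Abar \<eta> \<xi>) R \<Longrightarrow>
      \<exists>U. upper_half R = cmat T ** U \<and>
        lower_half R = cmat T ** diag_mat (\<chi> j. - (of_real (lam $ j) + q $ j)) ** U"
proof -
  \<comment> \<open>The scalar result is stated for all rows and all \<open>S\<close> at once, since \<open>q\<close> has to be chosen
    before \<open>R\<close>.\<close>
  define Q where "Q j c \<longleftrightarrow> stable_ratio (a $ j) (lam $ j) \<eta> \<xi> c \<and>
    (\<forall>(u :: complex ^ 2) p S. (\<forall>\<mu>. is_eigenvalue S \<mu> \<longrightarrow> Re \<mu> < 0) \<longrightarrow>
       (of_real (lam $ j) *s u + p) v* S = (- \<xi>) *s u \<longrightarrow>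
       (of_real (a $ j - (lam $ j)\<^sup>2) *s u - of_real (lam $ j) *s p) v* S = (- (\<eta> + \<xi>)) *s p \<longrightarrow>
       p = (- (of_real (lam $ j) + c)) *s u)" for j c
  have "\<exists>c. Q j c" for j
    by (rule stable_component[OF a[of j] \<eta> \<xi>, where 'n = 2]) (unfold Q_def, blast)
  define q where "q = (\<chi> j. SOME c. Q j c)"
  have q: "Q j (q $ j)" for j using someI_ex[OF \<open>\<exists>c. Q j c\<close>] by (simp add: q_def)
  let ?Ti = "matrix_inv T"
  note TT = matrix_inv_inverse[OF T]
  have cTT: "cmat T ** cmat ?Ti = mat 1" "cmat ?Ti ** cmat T = mat 1"
    using TT by (metis cmat_simps(1,6) of_real_1)+
  have TiF: "?Ti ** F = diag_mat lam ** ?Ti"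
    using F TT by (metis matrix_mul_assoc matrix_mul_rid)
  have TiFF: "?Ti ** (F ** F) = diag_mat lam ** diag_mat lam ** ?Ti"
    using TiF by (metis matrix_mul_assoc)
  have TiA: "?Ti ** (Abar - F ** F) = (diag_mat a - diag_mat lam ** diag_mat lam) ** ?Ti"
  proof -
    have "?Ti ** Abar = diag_mat a ** ?Ti" unfolding Abar using TT by (simp add: matrix_mul_assoc)
    then show ?thesis using TiFF by (simp add: matrix_ring_simps)
  qed
  have dd: "diag_mat a - diag_mat lam ** diag_mat lam = diag_mat (\<chi> j. a $ j - (lam $ j)\<^sup>2)"
    by (simp add: vec_eq_iff mult_diag_mat_entry) (simp add: diag_mat_def power2_eq_square)
  have A0: "invertible Abar"
  proof -
    have "a $ j \<noteq> 0" for j using a[of j] zero_le_power2[of "lam $ j"] by linarith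
    then have "det (diag_mat a) \<noteq> 0" by (simp add: det_2 diag_mat_def)
    moreover have "det T * det ?Ti = 1" by (metis TT(1) det_I det_mul)
    ultimately show ?thesis unfolding Abar invertible_det_nz det_mul by auto
  qed
  show ?thesis
  proof (rule that[of q])
    show "stable_ratio (a $ j) (lam $ j) \<eta> \<xi> (q $ j)" for j using q unfolding Q_def by blast
    fix R assume "right_stable (M_mat F Abar \<eta> \<xi>) R"
    then obtain S :: "complex ^ 2 ^ 2" where MR: "M_mat F Abar \<eta> \<xi> ** R = R ** S"
      and S: "\<forall>\<mu>. is_eigenvalue S \<mu> \<longrightarrow> Re \<mu> < 0" unfolding right_stable_def by blast
    define U P where "U = cmat ?Ti ** upper_half R" and "P = cmat ?Ti ** lower_half R"
    let ?L = "diag_mat (\<chi> j. of_real (lam $ j)) :: complex ^ 2 ^ 2"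
    have cF: "cmat ?Ti ** cmat F = ?L ** cmat ?Ti"
      using arg_cong[OF TiF, of cmat] by (simp add: cmat_simps)
    have cA: "cmat ?Ti ** cmat (Abar - F ** F)
        = diag_mat (\<chi> j. of_real (a $ j - (lam $ j)\<^sup>2)) ** cmat ?Ti"
      using arg_cong[OF TiA[unfolded dd], of cmat] unfolding cmat_simps(1,7) by simp
    note eqs = M_mat_equations[OF A0 MR]
    have 1: "(?L ** U + P) ** S = mat (- \<xi>) ** U"
      using arg_cong[OF eqs(1), of "\<lambda>X. cmat ?Ti ** X"] cF
      by (simp add: U_def P_def matrix_add_ldistrib matrix_mul_assoc mat_mult_commute)
    have 2: "(diag_mat (\<chi> j. of_real (a $ j - (lam $ j)\<^sup>2)) ** U - ?L ** P) ** S
        = mat (- (\<eta> + \<xi>)) ** P"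
      using arg_cong[OF eqs(2), of "\<lambda>X. cmat ?Ti ** X"] cF cA
      by (simp add: U_def P_def matrix_ring_simps matrix_mul_assoc mat_mult_commute)
    have row: "P $ j = (- (of_real (lam $ j) + q $ j)) *s U $ j" for j
    proof -
      have "(of_real (lam $ j) *s U $ j + P $ j) v* S = (- \<xi>) *s U $ j"
        using arg_cong[OF 1, of "\<lambda>X. X $ j"]
        by (simp add: matrix_mult_row[of "_ + _"] diag_mat_mult_row mat_mult_eq)
      moreover have "(of_real (a $ j - (lam $ j)\<^sup>2) *s U $ j - of_real (lam $ j) *s P $ j) v* S
          = (- (\<eta> + \<xi>)) *s P $ j"
        using arg_cong[OF 2, of "\<lambda>X. X $ j"]
        by (simp add: matrix_mult_row[of "_ - _"] diag_mat_mult_row mat_mult_eq)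
      ultimately show ?thesis using q[of j] S unfolding Q_def by blast
    qed
    have "P = diag_mat (\<chi> j. - (of_real (lam $ j) + q $ j)) ** U"
      unfolding vec_eq_iff[where 'b = 2 and 'a = "complex ^ 2"] diag_mat_mult_row using row by simp
    moreover have "upper_half R = cmat T ** U" "lower_half R = cmat T ** P"
      by (simp_all add: U_def P_def matrix_mul_assoc cTT)
    ultimately show "\<exists>U. upper_half R = cmat T ** U \<and>
        lower_half R = cmat T ** diag_mat (\<chi> j. - (of_real (lam $ j) + q $ j)) ** U"
      by (intro exI[of _ U]) (simp add: matrix_mul_assoc)
  qed
qed

text \<open>With \<open>U\<close> as in \<open>stable_half_relation\<close>, the determinant of \<open>B R\<close> is that of the boundary symbol
  times \<open>det U\<close>, and the Gram determinant of \<open>R\<close> is \<open>(cmod (det U))\<^sup>2\<close> times the Gram determinant of the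
  matrix with halves \<open>T\<close> and \<open>T C\<close>, whose entries are bounded by \<open>norm T * K\<close>.\<close>

lemma GKC_from_boundary_symbol:
  fixes T F Abar Bu Bp :: "real ^ 2 ^ 2" and lam a :: "real ^ 2"
  assumes T: "invertible T"
    and F: "matrix_inv T ** F ** T = diag_mat lam"
    and Abar: "Abar = T ** diag_mat a ** matrix_inv T"
    and a: "\<And>j. a $ j > (lam $ j)\<^sup>2"
    and c: "c > 0"
    and bound: "\<And>\<eta> \<xi> q. \<eta> \<ge> 0 \<Longrightarrow> Re \<xi> > 0 \<Longrightarrow>
      (\<And>j. stable_ratio (a $ j) (lam $ j) \<eta> \<xi> (q $ j)) \<Longrightarrow>
      c \<le> cmod (det (cmat (Bu ** T) + cmat (Bp ** T) ** diag_mat (\<chi> j. - (of_real (lam $ j) + q $ j))))"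
  shows "GKC F Abar (block_row Bu Bp)"
proof -
  define K where "K = (\<Sum>j\<in>UNIV. a $ j + 2 * \<bar>lam $ j\<bar> + 1)"
  have a0: "a $ j > 0" for j using a[of j] zero_le_power2[of "lam $ j"] by linarith
  have Kj: "a $ j + 2 * \<bar>lam $ j\<bar> + 1 \<le> K" for j
    unfolding K_def using a0 by (intro member_le_sum) (auto simp: add_nonneg_nonneg less_imp_le)
  have K1: "K \<ge> 1" using Kj[of 1] a0[of 1] by linarith
  \<comment> \<open>\<open>K \<ge> 1\<close> makes \<open>\<tau>\<close> a common bound for the entries of \<open>T\<close> and of \<open>T C\<close>.\<close>
  define \<tau> where "\<tau> = norm T * K"
  define g where "g = sqrt (32 * \<tau> ^ 4) + 1"
  have g: "g > 0" unfolding g_def by (simp add: add_nonneg_pos)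
  have Tij: "\<bar>T $ i $ j\<bar> \<le> norm T" for i j
    using component_le_norm_cart[of "T $ i" j] Finite_Cartesian_Product.norm_nth_le[of T i]
    by simp
  show ?thesis unfolding GKC_def
  proof (intro exI[of _ "c / g"] conjI allI impI)
    show "c / g > 0" using c g by simp
    fix \<eta> :: real and \<xi> R
    assume \<eta>: "0 \<le> \<eta>" and \<xi>: "0 < Re \<xi>" and R: "right_stable (M_mat F Abar \<eta> \<xi>) R"
    obtain q :: "complex ^ 2" where q: "\<And>j. stable_ratio (a $ j) (lam $ j) \<eta> \<xi> (q $ j)"
      and rel: "\<And>R. right_stable (M_mat F Abar \<eta> \<xi>) R \<Longrightarrow> \<exists>U. upper_half R = cmat T ** U \<and>
        lower_half R = cmat T ** diag_mat (\<chi> j. - (of_real (lam $ j) + q $ j)) ** U"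
      using stable_half_relation[OF T F Abar a \<eta> \<xi>] by blast
    let ?C = "diag_mat (\<chi> j. - (of_real (lam $ j) + q $ j)) :: complex ^ 2 ^ 2"
    let ?Q = "cmat T ** ?C"
    obtain U where U: "upper_half R = cmat T ** U" "lower_half R = ?Q ** U" using rel[OF R] by blast
    have qK: "cmod (of_real (lam $ j) + q $ j) \<le> K" for j
      using norm_triangle_ineq[of "of_real (lam $ j)" "q $ j"] stable_ratio_bound[OF a \<eta> \<xi> q, of j] Kj[of j]
      by simp
    have P: "cmod (cmat T $ i $ j) \<le> \<tau>" for i j
      using mult_mono[OF Tij[of i j] K1] by (simp add: \<tau>_def map_matrix_def)
    have Q: "cmod (?Q $ i $ j) \<le> \<tau>" for i j
    proof -
      have "?Q $ i $ j = of_real (T $ i $ j) * - (of_real (lam $ j) + q $ j)"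
        by (simp add: mult_diag_mat_entry map_matrix_def)
      then have "cmod (?Q $ i $ j) = \<bar>T $ i $ j\<bar> * cmod (of_real (lam $ j) + q $ j)"
        by (simp only: norm_mult norm_minus_cancel norm_of_real)
      then show ?thesis unfolding \<tau>_def using mult_mono[OF Tij[of i j] qK[of j]] by simp
    qed
    let ?G = "conj_transpose (cmat T) ** cmat T + conj_transpose ?Q ** ?Q"
    have "Re (det (conj_transpose R ** R)) \<le> (cmod (det U))\<^sup>2 * cmod (det ?G)"
      unfolding gram_det_factor[OF U] by (simp add: complex_Re_le_cmod mult_left_mono flip: of_real_power)
    also have "\<dots> \<le> (cmod (det U))\<^sup>2 * (32 * \<tau> ^ 4)"
      by (intro mult_left_mono gram_det_le P Q) auto
    finally have "sqrt (Re (det (conj_transpose R ** R))) \<le> sqrt ((cmod (det U))\<^sup>2 * (32 * \<tau> ^ 4))"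
      by (rule real_sqrt_le_mono)
    also have "\<dots> \<le> cmod (det U) * g" by (simp add: real_sqrt_mult g_def mult_left_mono)
    finally have gram: "c / g * sqrt (Re (det (conj_transpose R ** R))) \<le> c / g * (cmod (det U) * g)"
      using c g by (intro mult_left_mono) auto
    have "cmat (block_row Bu Bp) ** R = (cmat (Bu ** T) + cmat (Bp ** T) ** ?C) ** U"
      unfolding map_matrix_block_row block_row_mult U
      by (simp add: cmat_simps matrix_ring_simps matrix_mul_assoc)
    then have "cmod (det (cmat (block_row Bu Bp) ** R))
        = cmod (det (cmat (Bu ** T) + cmat (Bp ** T) ** ?C)) * cmod (det U)"
      by (simp add: det_mul norm_mult)
    also have "\<dots> \<ge> c * cmod (det U)" by (intro mult_right_mono bound[OF \<eta> \<xi> q]) auto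
    finally show "c / g * sqrt (Re (det (conj_transpose R ** R))) \<le> cmod (det (cmat (block_row Bu Bp) ** R))"
      using gram g by simp
  qed
qed

theorem proposition5p3:
  fixes F T Abar Bu :: "real ^ 2 ^ 2"
    and Bhat :: "real ^ 2 ^ 1"
    and lam a :: "real ^ 2"
    and H Ct :: real
    and bu1 bu2 bp2 :: "real ^ 2"
  assumes T: "invertible T"
    and F: "matrix_inv T ** F ** T = diag_mat lam"
    and lam: "lam $ 1 > 0" "0 > lam $ 2"
    and Abar: "Abar = T ** diag_mat a ** matrix_inv T"
    and a_pos: "\<forall>j. a $ j > 0"
    and a_lam: "\<forall>j. a $ j > (lam $ j)\<^sup>2"
    and Bhat: "(Bhat *v column 1 T) $ 1 \<noteq> 0"
    and H: "H = - (inverse ((Bhat *v column 1 T) $ 1) * (Bhat *v column 2 T) $ 1)"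
    and Bu: "invertible Bu"
    and bu: "bu1 = column 1 (Bu ** T)" "bu2 = column 2 (Bu ** T)"
    and Ct: "Ct \<in> {lam $ 2 - (lam $ 2)\<^sup>2 / sqrt (a $ 2) <..< 0} \<union> {0 <..}"
    and bp2: "bp2 = - ((H / Ct) *\<^sub>R bu1) + ((Ct - lam $ 2) / (lam $ 2 * Ct)) *\<^sub>R bu2"
  shows "\<exists>\<delta> > 0. \<forall>bp1 :: real ^ 2. norm bp1 < \<delta> \<longrightarrow>
    (\<forall>Bp :: real ^ 2 ^ 2. column 1 (Bp ** T) = bp1 \<and> column 2 (Bp ** T) = bp2 \<longrightarrow>
      GKC F Abar (block_row Bu Bp))"
proof -
  have aj: "a $ j > (lam $ j)\<^sup>2" for j using a_lam by simp
  define k where "k = (Ct - lam $ 2) / (lam $ 2 * Ct)"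
  obtain \<epsilon> where \<epsilon>: "\<epsilon> > 0"
    and factor: "\<And>\<eta> \<xi> q. \<eta> \<ge> 0 \<Longrightarrow> Re \<xi> > 0 \<Longrightarrow> stable_ratio (a $ 2) (lam $ 2) \<eta> \<xi> q \<Longrightarrow>
      \<epsilon> \<le> cmod (1 - (of_real (lam $ 2) + q) * of_real k)"
    using stable_ratio_boundary_factor[OF aj lam(2) Ct k_def] by blast
  define D where "D = det (Bu ** T)"
  have D0: "D \<noteq> 0" using T Bu by (simp add: D_def det_mul invertible_det_nz)
  define K where "K j = a $ j + 2 * \<bar>lam $ j\<bar> + 1" for j
  have K0: "K j \<ge> 0" for j using aj[of j] zero_le_power2[of "lam $ j"] unfolding K_def by linarith
  define m where "m = norm bu2 + K 2 * norm bp2"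
  have m0: "m \<ge> 0" using K0[of 2] by (simp add: m_def)
  define N where "N = 2 * K 1 * m + 1"
  \<comment> \<open>The perturbation \<open>c 1 * ?e\<close> below is at most \<open>\<delta> * (2 * K 1 * m)\<close>, and this is to be half of the
    lower bound \<open>\<bar>D\<bar> * \<epsilon>\<close> of the unperturbed determinant; adding \<open>1\<close> in \<open>N\<close> avoids division by zero.\<close>
  define \<delta> where "\<delta> = \<bar>D\<bar> * \<epsilon> / (2 * N)"
  have den: "N > 0" using K0[of 1] m0 by (simp add: N_def add_nonneg_pos)
  have \<delta>: "\<delta> > 0" using den D0 \<epsilon> by (simp add: \<delta>_def)
  show ?thesis
  proof (intro exI[of _ \<delta>] conjI allI impI \<delta>)
    fix bp1 :: "real ^ 2" and Bp :: "real ^ 2 ^ 2"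
    assume bp1: "norm bp1 < \<delta>" and Bp: "column 1 (Bp ** T) = bp1 \<and> column 2 (Bp ** T) = bp2"
    show "GKC F Abar (block_row Bu Bp)"
    proof (rule GKC_from_boundary_symbol[OF T F Abar aj, of "\<bar>D\<bar> * \<epsilon> / 2"])
      show "\<bar>D\<bar> * \<epsilon> / 2 > 0" using D0 \<epsilon> by simp
      fix \<eta> :: real and \<xi> and q :: "complex ^ 2"
      assume \<eta>: "\<eta> \<ge> 0" and \<xi>: "Re \<xi> > 0" and q: "\<And>j. stable_ratio (a $ j) (lam $ j) \<eta> \<xi> (q $ j)"
      define c where "c j = - (of_real (lam $ j) + q $ j)" for j
      have cK: "cmod (c j) \<le> K j" for j
        using norm_triangle_ineq[of "of_real (lam $ j)" "q $ j"] stable_ratio_bound[OF aj \<eta> \<xi> q, of j]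
        unfolding c_def norm_minus_cancel K_def by simp
      let ?W = "cmat (Bu ** T) + cmat (Bp ** T) ** diag_mat (\<chi> j. - (of_real (lam $ j) + q $ j))"
      let ?r = "\<lambda>i. of_real (bu2 $ i) + c 2 * of_real (bp2 $ i)"
      let ?e = "of_real (bp1 $ 1) * ?r 2 - of_real (bp1 $ 2) * ?r 1"
      have BuT: "(Bu ** T) $ i $ 1 = bu1 $ i" "(Bu ** T) $ i $ 2 = bu2 $ i"
        and BpT: "(Bp ** T) $ i $ 1 = bp1 $ i" "(Bp ** T) $ i $ 2 = bp2 $ i" for i
        using bu conjunct1[OF Bp] conjunct2[OF Bp] by (simp_all add: column_def vec_eq_iff)
      have W: "?W $ i $ j = of_real ((Bu ** T) $ i $ j) + c j * of_real ((Bp ** T) $ i $ j)" for i j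
        by (simp add: mult_diag_mat_entry c_def mult.commute map_matrix_def)
      have b: "bp2 $ i = - (H / Ct) * bu1 $ i + k * bu2 $ i" for i by (simp add: bp2 k_def)
      have "det ?W = (of_real (bu1 $ 1) + c 1 * of_real (bp1 $ 1)) * ?r 2
          - ?r 1 * (of_real (bu1 $ 2) + c 1 * of_real (bp1 $ 2))"
        unfolding det_2 W BuT BpT ..
      also have "\<dots> = (of_real (bu1 $ 1) * ?r 2 - ?r 1 * of_real (bu1 $ 2)) + c 1 * ?e"
        by (simp add: algebra_simps)
      also have "of_real (bu1 $ 1) * ?r 2 - ?r 1 * of_real (bu1 $ 2)
          = of_real D * (1 + c 2 * of_real k)"
        unfolding b D_def det_2 BuT by (simp add: algebra_simps)
      finally have det: "det ?W = of_real D * (1 + c 2 * of_real k) + c 1 * ?e" .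
      have r: "cmod (?r i) \<le> m" for i
      proof -
        have "cmod (?r i) \<le> \<bar>bu2 $ i\<bar> + cmod (c 2) * \<bar>bp2 $ i\<bar>"
          using norm_triangle_ineq[of "of_real (bu2 $ i)" "c 2 * of_real (bp2 $ i)"] by (simp add: norm_mult)
        also have "\<dots> \<le> norm bu2 + K 2 * norm bp2"
          using cK K0 by (intro add_mono mult_mono component_le_norm_cart) auto
        finally show ?thesis by (simp add: m_def)
      qed
      have p: "\<bar>bp1 $ i\<bar> \<le> \<delta>" for i using component_le_norm_cart[of bp1 i] bp1 by linarith
      have "cmod ?e \<le> \<delta> * m + \<delta> * m"
        using norm_triangle_ineq4[of "of_real (bp1 $ 1) * ?r 2" "of_real (bp1 $ 2) * ?r 1"]
          mult_mono[OF p[of 1] r[of 2]] mult_mono[OF p[of 2] r[of 1]] \<delta>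
        by (simp add: norm_mult)
      then have "cmod (c 1 * ?e) \<le> K 1 * (2 * (\<delta> * m))"
        unfolding norm_mult using cK K0 by (intro mult_mono) auto
      also have "\<dots> = \<delta> * (2 * K 1 * m)" by simp
      also have "\<dots> \<le> \<delta> * N" using \<delta> by (intro mult_left_mono) (auto simp: N_def)
      also have "\<dots> = \<bar>D\<bar> * \<epsilon> / 2" using den by (simp add: \<delta>_def)
      finally have small: "cmod (c 1 * ?e) \<le> \<bar>D\<bar> * \<epsilon> / 2" .
      have "1 + c 2 * of_real k = 1 - (of_real (lam $ 2) + q $ 2) * of_real k" by (simp add: c_def algebra_simps)
      then have "\<epsilon> \<le> cmod (1 + c 2 * of_real k)" using factor[OF \<eta> \<xi> q] by simp
      then have "\<bar>D\<bar> * \<epsilon> \<le> cmod (of_real D * (1 + c 2 * of_real k))"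
        unfolding norm_mult by (simp add: mult_left_mono)
      with small show "\<bar>D\<bar> * \<epsilon> / 2 \<le> cmod (det ?W)"
        unfolding det using norm_diff_ineq[of "of_real D * (1 + c 2 * of_real k)" "c 1 * ?e"] by linarith
    qed
  qed
qed

end
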